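(* Let $2\le m<n$ be integers, and let $E$ and $F$ be totally disconnected self-affine (Bedford–McMullen) carpets, both with expanding matrix $\mathrm{diag}(n,m)$. If $f:E\to F$ is a bi-Lipschitz map of $E$ onto $F$, then $\mu_F\circ f$ is equivalent to $\mu_E$, namely, there exists $\zeta>0$ such that $$\zeta^{-1}\mu_E(A)\le \mu_F(f(A))\le \zeta\,\mu_E(A)$$ for every Borel set $A\subset E$.
   Context: Let $2\le m<n$ be integers and let $\mathcal D\subset\{0,1,\dots,n-1\}\times\{0,1,\dots,m-1\}$ be a non-empty set (the digit set). For $d\in\mathcal D$ let $S_d:\mathbb R^2\to\mathbb R^2$, $S_d(z)=\mathrm{diag}(n^{-1},m^{-1})(z+d)$. The self-affine carpet $E=K(n,m,\mathcal D)$ is the unique non-empty compact set with $E=\bigcup_{d\in\mathcal D}S_d(E)$; it is said to have expanding matrix $\mathrm{diag}(n,m)$. The uniform Bernoulli measure $\mu_E$ is the unique Borel probability measure on $E$ satisfying $\mu_E(\cdot)=\sum_{d\in\mathcal D}\frac1N\,\mu_E\circ S_d^{-1}(\cdot)$, where $N=\#\mathcal D$. The measure $\mu_F$ is defined in the same way from the digit set of $F$. A map $f:X\to Y$ between metric spaces is bi-Lipschitz if there is $C>0$ with $C^{-1}d_X(x,y)\le d_Y(f(x),f(y))\le C\,d_X(x,y)$ for all $x,y\in X$. Carpets carry the Euclidean metric. *)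

theory Defs
  imports "HOL-Probability.Probability"
begin

(* The plane is the type real \<times> real, whose library metric is the Euclidean one. *)

definition digit_set :: "nat \<Rightarrow> nat \<Rightarrow> (nat \<times> nat) set \<Rightarrow> bool" where
  "digit_set n m D \<longleftrightarrow> D \<noteq> {} \<and> D \<subseteq> {0..<n} \<times> {0..<m}"

definition carpet_map :: "nat \<Rightarrow> nat \<Rightarrow> nat \<times> nat \<Rightarrow> real \<times> real \<Rightarrow> real \<times> real" where
  "carpet_map n m d z = ((fst z + real (fst d)) / real n, (snd z + real (snd d)) / real m)"

(* K = K(n,m,D): for n, m \<ge> 2 and a digit set D, exactly one K satisfies this predicate. *)
definition is_carpet :: "nat \<Rightarrow> nat \<Rightarrow> (nat \<times> nat) set \<Rightarrow> (real \<times> real) set \<Rightarrow> bool" where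
  "is_carpet n m D K \<longleftrightarrow> K \<noteq> {} \<and> compact K \<and> K = (\<Union>d\<in>D. carpet_map n m d ` K)"

(* The measure lives on K itself: its space is K and its measurable sets are the Borel subsets
   of K, so the preimage of A under a carpet map is taken within K. For such n, m, D and K,
   exactly one measure satisfies this predicate. *)
definition is_uniform_bernoulli ::
  "nat \<Rightarrow> nat \<Rightarrow> (nat \<times> nat) set \<Rightarrow> (real \<times> real) set \<Rightarrow> (real \<times> real) measure \<Rightarrow> bool" where
  "is_uniform_bernoulli n m D K \<mu> \<longleftrightarrow>
     prob_space \<mu> \<and> sets \<mu> = sets (restrict_space borel K) \<and>
     (\<forall>A\<in>sets \<mu>. measure \<mu> A =
        (\<Sum>d\<in>D. 1 / real (card D) * measure \<mu> (carpet_map n m d -` A \<inter> space \<mu>)))"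

definition totally_disconnected :: "'a::topological_space set \<Rightarrow> bool" where
  "totally_disconnected S \<longleftrightarrow> (\<forall>C. C \<subseteq> S \<and> connected C \<longrightarrow> (\<forall>x\<in>C. \<forall>y\<in>C. x = y))"

definition bi_lipschitz_on ::
  "'a::metric_space set \<Rightarrow> ('a \<Rightarrow> 'b::metric_space) \<Rightarrow> bool" where
  "bi_lipschitz_on X f \<longleftrightarrow>
     (\<exists>C>0. \<forall>x\<in>X. \<forall>y\<in>X.
        inverse C * dist x y \<le> dist (f x) (f y) \<and> dist (f x) (f y) \<le> C * dist x y)"

end

theory Submission
  imports Defs
begin

text \<open>
  The uniform Bernoulli measure of a carpet can be recovered, up to constants, from box counting,
  and box counting is stable under bi-Lipschitz maps.

  Fix a level \<open>l\<close> and cut the plane into boxes of width \<open>n\<^sup>-\<^sup>l\<close> and height \<open>m\<^sup>-\<^sup>k\<close>,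
  where \<open>m\<^sup>k\<close> is the first power of \<open>m\<close> that reaches \<open>n\<^sup>l\<close>; these boxes are nearly squares,
  all of about the same size. Let \<open>N\<close> be the number of digits and \<open>R\<^sub>r\<close> the number of vertical
  words of length \<open>r\<close>. The whole carpet meets about \<open>N\<^sup>l R\<^sub>k\<^sub>-\<^sub>l\<close> boxes, since a box is determined
  by \<open>l\<close> full digits and \<open>k - l\<close> further vertical digits. For the same reason a union of \<open>q\<close>
  cylinders of rank \<open>p \<le> l\<close> meets about \<open>q N\<^sup>l\<^sup>-\<^sup>p R\<^sub>k\<^sub>-\<^sub>l\<close> boxes, that is, a
  proportion of about \<open>q / N\<^sup>p\<close>. This proportion does not depend on how the measure is spread over the
  boxes inside a cylinder, which may be very uneven, and it is exactly the mass that self-similarity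
  gives to \<open>q\<close> words of length \<open>p\<close>. All comparisons are up to a factor \<open>4\<close>, which accounts
  for points lying on the boundary of boxes.

  If \<open>U\<close> contains a neighbourhood of \<open>A\<close> in the carpet, then the cylinders of a large rank that
  meet \<open>A\<close> lie in \<open>U\<close>. Counting them shows that the proportion of boxes met by \<open>A\<close> is at most
  \<open>4 \<mu>(U)\<close>, and that the proportion met by \<open>U\<close> is at least \<open>\<mu>(A) / 4\<close>
  (lemma \<open>neighbourhood_box_count\<close>). A set \<open>V\<close> between \<open>K\<close> and \<open>U\<close> then carries the
  estimate across a bi-Lipschitz map \<open>f\<close>: the mass of \<open>f(K)\<close> is controlled by the boxes
  met by \<open>f(V)\<close>, these by the boxes met by \<open>V\<close>, and these by the mass of \<open>U\<close>. The total
  box counts of the two carpets are comparable too, because \<open>f\<close> maps one carpet onto the other.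
  Regularity of the measures extends the bound to Borel sets, and the opposite bound is the same
  statement for the inverse map.
\<close>

section \<open>Products of digit sets\<close>

text \<open>
  Composing a map of the carpet for \<open>diag(n', m')\<close> with one for \<open>diag(n, m)\<close> gives again such a
  map, with the digit read in mixed radix. A carpet is therefore also a carpet for the product
  digit set, so that its rank \<open>p\<close> cylinders are the first-level pieces for \<open>diag(n\<^sup>p, m\<^sup>p)\<close>
  and words of length \<open>p\<close> are just pairs of integers.
\<close>

definition digit_prod ::
  "nat \<Rightarrow> nat \<Rightarrow> (nat \<times> nat) set \<Rightarrow> (nat \<times> nat) set \<Rightarrow> (nat \<times> nat) set" where
  "digit_prod n m W D = (\<lambda>(w, d). (fst w * n + fst d, snd w * m + snd d)) ` (W \<times> D)"

lemma carpet_map_compose: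
  assumes "n' > 0" "m' > 0"
  shows "carpet_map n m w (carpet_map n' m' d z) =
         carpet_map (n * n') (m * m') (fst w * n' + fst d, snd w * m' + snd d) z"
  using assms by (simp add: carpet_map_def field_simps)

lemma digit_prodI:
  "w \<in> W \<Longrightarrow> d \<in> D \<Longrightarrow> (fst w * n + fst d, snd w * m + snd d) \<in> digit_prod n m W D"
  unfolding digit_prod_def by force

lemma inj_on_digit_prod:
  fixes W D :: "(nat \<times> nat) set"
  assumes "D \<subseteq> {0..<n} \<times> {0..<m}"
  shows "inj_on (\<lambda>(w, d). (fst w * n + fst d, snd w * m + snd d)) (W \<times> D)"
proof -
  have *: "i = i' \<and> a = a'" if "i * k + a = i' * k + a'" "a < k" "a' < k" for i i' a a' k :: nat
  proof -
    have "(i * k + a) div k = i" "(i' * k + a') div k = i'" using that(2,3) by auto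
    with that(1) have "i = i'" by simp
    with that(1) show ?thesis by simp
  qed
  show ?thesis
  proof (rule inj_onI, clarsimp)
    fix i j a b i' j' a' b' :: nat
    assume h: "(a, b) \<in> D" "(a', b') \<in> D"
      "i * n + a = i' * n + a'" "j * m + b = j' * m + b'"
    have "a < n" "a' < n" "b < m" "b' < m" using h assms by auto
    then show "i = i' \<and> j = j' \<and> a = a' \<and> b = b'"
      using *[of i n a i' a'] *[of j m b j' b'] h(3,4) by simp
  qed
qed

lemma card_digit_prod:
  assumes "D \<subseteq> {0..<n} \<times> {0..<m}"
  shows "card (digit_prod n m W D) = card W * card D"
  unfolding digit_prod_def card_image[OF inj_on_digit_prod[OF assms]]
  by (rule card_cartesian_product)

lemma digit_set_finite: "digit_set n m D \<Longrightarrow> finite D"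
  unfolding digit_set_def by (meson finite_SigmaI finite_atLeastLessThan finite_subset)

lemma digit_set_prod:
  assumes "digit_set n m W" "digit_set n' m' D"
  shows "digit_set (n * n') (m * m') (digit_prod n' m' W D)"
proof -
  have *: "i * k + a < l * k" if "i < l" "a < k" for i k a l :: nat
  proof -
    have "i * k + a < (i + 1) * k" using that by simp
    also have "\<dots> \<le> l * k" using that by (intro mult_right_mono) auto
    finally show ?thesis .
  qed
  show ?thesis
    using assms by (force simp: digit_set_def digit_prod_def intro: *)
qed

lemma is_carpet_prod:
  assumes "n' > 0" "m' > 0" "is_carpet n m W K" "is_carpet n' m' D K"
  shows "is_carpet (n * n') (m * m') (digit_prod n' m' W D) K"
proof -
  have W: "K = (\<Union>w\<in>W. carpet_map n m w ` K)" and D: "K = (\<Union>d\<in>D. carpet_map n' m' d ` K)"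
    using assms(3,4) unfolding is_carpet_def by auto
  have "(\<Union>d\<in>digit_prod n' m' W D. carpet_map (n * n') (m * m') d ` K)
      = (\<Union>w\<in>W. \<Union>d\<in>D. (\<lambda>z. carpet_map n m w (carpet_map n' m' d z)) ` K)"
    unfolding carpet_map_compose[OF assms(1,2)] digit_prod_def by auto
  also have "\<dots> = (\<Union>w\<in>W. carpet_map n m w ` (\<Union>d\<in>D. carpet_map n' m' d ` K))"
    by (simp add: image_UN image_image)
  also have "\<dots> = K" using W D by simp
  finally show ?thesis using assms(3) unfolding is_carpet_def by auto
qed

lemma is_carpet_map_in:
  assumes "is_carpet n m D K" "d \<in> D" "z \<in> K"
  shows "carpet_map n m d z \<in> K"
  using assms unfolding is_carpet_def by blast

lemma uniform_bernoulli_space: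
  assumes "is_uniform_bernoulli n m D K \<mu>"
  shows "space \<mu> = K"
proof -
  have "sets \<mu> = sets (restrict_space borel K)"
    using assms unfolding is_uniform_bernoulli_def by auto
  from sets_eq_imp_space_eq[OF this] show ?thesis by (simp add: space_restrict_space)
qed

lemma carpet_map_measurable:
  assumes "is_carpet n m D K" "d \<in> D" "is_uniform_bernoulli n m D K \<mu>" "A \<in> sets \<mu>"
  shows "carpet_map n m d -` A \<inter> K \<in> sets \<mu>"
proof -
  have s: "sets \<mu> = sets (restrict_space borel K)"
    using assms unfolding is_uniform_bernoulli_def by auto
  have "continuous_on K (carpet_map n m d)"
    unfolding carpet_map_def divide_inverse by (intro continuous_intros)
  then have "carpet_map n m d \<in> borel_measurable (restrict_space borel K)"
    by (rule borel_measurable_continuous_on_restrict)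
  then have "carpet_map n m d \<in> measurable (restrict_space borel K) (restrict_space borel K)"
    using is_carpet_map_in[OF assms(1,2)]
    by (intro measurable_restrict_space2) (auto simp: space_restrict_space)
  from measurable_sets[OF this, of A] show ?thesis
    using assms(4) by (simp add: s space_restrict_space)
qed

lemma uniform_bernoulli_prod:
  assumes "n' > 0" "m' > 0" "digit_set n' m' D"
    and "is_carpet n m W K" "is_carpet n' m' D K"
    and W: "is_uniform_bernoulli n m W K \<mu>" and D: "is_uniform_bernoulli n' m' D K \<mu>"
  shows "is_uniform_bernoulli (n * n') (m * m') (digit_prod n' m' W D) K \<mu>"
proof -
  have sub: "D \<subseteq> {0..<n'} \<times> {0..<m'}" using assms(3) by (simp add: digit_set_def)
  have sp: "space \<mu> = K" by (rule uniform_bernoulli_space[OF W])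
  have "measure \<mu> A = (\<Sum>v\<in>digit_prod n' m' W D. 1 / real (card (digit_prod n' m' W D)) *
          measure \<mu> (carpet_map (n * n') (m * m') v -` A \<inter> space \<mu>))" if A: "A \<in> sets \<mu>" for A
  proof -
    have "measure \<mu> A = (\<Sum>w\<in>W. 1 / real (card W) * measure \<mu> (carpet_map n m w -` A \<inter> K))"
      using W A unfolding is_uniform_bernoulli_def sp by auto
    also have "\<dots> = (\<Sum>w\<in>W. \<Sum>d\<in>D. 1 / real (card W * card D) *
        measure \<mu> (carpet_map (n * n') (m * m') (fst w * n' + fst d, snd w * m' + snd d) -` A \<inter> K))"
    proof (rule sum.cong[OF refl])
      fix w assume w: "w \<in> W"
      have B: "carpet_map n m w -` A \<inter> K \<in> sets \<mu>"
        by (rule carpet_map_measurable[OF assms(4) w W A])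
      have pre: "carpet_map n' m' d -` (carpet_map n m w -` A \<inter> K) \<inter> K =
          carpet_map (n * n') (m * m') (fst w * n' + fst d, snd w * m' + snd d) -` A \<inter> K"
        if "d \<in> D" for d
        using is_carpet_map_in[OF assms(5) that]
        by (auto simp flip: carpet_map_compose[OF assms(1,2)])
      have "measure \<mu> (carpet_map n m w -` A \<inter> K) = (\<Sum>d\<in>D. 1 / real (card D) *
          measure \<mu> (carpet_map n' m' d -` (carpet_map n m w -` A \<inter> K) \<inter> K))"
        using D B unfolding is_uniform_bernoulli_def sp by auto
      also have "\<dots> = (\<Sum>d\<in>D. 1 / real (card D) * measure \<mu>
          (carpet_map (n * n') (m * m') (fst w * n' + fst d, snd w * m' + snd d) -` A \<inter> K))"
        using pre by (intro sum.cong) auto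
      finally show "1 / real (card W) * measure \<mu> (carpet_map n m w -` A \<inter> K) =
        (\<Sum>d\<in>D. 1 / real (card W * card D) * measure \<mu>
          (carpet_map (n * n') (m * m') (fst w * n' + fst d, snd w * m' + snd d) -` A \<inter> K))"
        by (simp add: sum_distrib_left)
    qed
    also have "\<dots> = (\<Sum>v\<in>digit_prod n' m' W D. 1 / real (card W * card D) *
          measure \<mu> (carpet_map (n * n') (m * m') v -` A \<inter> K))"
      unfolding digit_prod_def sum.reindex[OF inj_on_digit_prod[OF sub]]
      by (simp add: sum.cartesian_product case_prod_unfold)
    finally show ?thesis unfolding card_digit_prod[OF sub] sp .
  qed
  then show ?thesis using W unfolding is_uniform_bernoulli_def by auto
qed

fun digit_power :: "nat \<Rightarrow> nat \<Rightarrow> (nat \<times> nat) set \<Rightarrow> nat \<Rightarrow> (nat \<times> nat) set" where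
  "digit_power n m D 0 = {(0, 0)}"
| "digit_power n m D (Suc p) = digit_prod n m (digit_power n m D p) D"

section \<open>Grids of approximate squares\<close>

text \<open>
  Boxes of width \<open>n\<^sup>-\<^sup>l\<close> and height \<open>m\<^sup>-\<^sup>k\<close> with \<open>k = row_level n m l\<close> have comparable sides;
  the grid map sends a point to the integer coordinates of its box, so that the cardinality of
  the image of a set counts the boxes that the set meets.
\<close>

definition row_level :: "nat \<Rightarrow> nat \<Rightarrow> nat \<Rightarrow> nat" where
  "row_level n m l = (LEAST k. n ^ l \<le> m ^ k)"

definition grid :: "nat \<Rightarrow> nat \<Rightarrow> nat \<Rightarrow> real \<times> real \<Rightarrow> int \<times> int" where
  "grid n m l z = (\<lfloor>real (n ^ l) * fst z\<rfloor>, \<lfloor>real (m ^ row_level n m l) * snd z\<rfloor>)"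

lemma row_level_bounds:
  assumes "2 \<le> m" "m < n"
  shows "n ^ l \<le> m ^ row_level n m l" "m ^ row_level n m l \<le> m * n ^ l" "l \<le> row_level n m l"
proof -
  let ?k = "row_level n m l"
  have "n ^ l < 2 ^ (n ^ l)" by (rule less_exp)
  also have "\<dots> \<le> m ^ (n ^ l)" using assms by (intro power_mono) auto
  finally have ex: "n ^ l \<le> m ^ (n ^ l)" by simp
  show 1: "n ^ l \<le> m ^ ?k" unfolding row_level_def by (rule LeastI, rule ex)
  show "m ^ ?k \<le> m * n ^ l"
  proof (cases ?k)
    case 0
    then show ?thesis using assms by simp
  next
    case (Suc j)
    then have "\<not> n ^ l \<le> m ^ j" unfolding row_level_def by (intro not_less_Least) auto
    then show ?thesis unfolding Suc by simp
  qed
  have "m ^ l \<le> n ^ l" using assms by (intro power_mono) auto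
  also note 1
  finally show "l \<le> ?k" using assms by simp
qed

lemma card_le_translates:
  fixes X :: "'a::ab_group_add set"
  assumes "finite Y" "finite T" "\<And>x. x \<in> X \<Longrightarrow> \<exists>y\<in>Y. x - h y \<in> T"
  shows "finite X" "card X \<le> card Y * card T"
proof -
  have "X \<subseteq> (\<lambda>(y, t). h y + t) ` (Y \<times> T)"
  proof
    fix x assume "x \<in> X"
    then obtain y where "y \<in> Y" "x - h y \<in> T" using assms(3) by blast
    then show "x \<in> (\<lambda>(y, t). h y + t) ` (Y \<times> T)"
      by (intro image_eqI[of _ _ "(y, x - h y)"]) auto
  qed
  then show "finite X" "card X \<le> card Y * card T"
    using assms(1,2) surj_card_le[of "Y \<times> T" X]
    by (auto simp: card_cartesian_product intro: finite_subset)
qed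

text \<open>
  A box of the level \<open>l\<close> grid has diameter at most \<open>2 / n ^ l\<close>, hence its image under a
  \<open>C\<close>-Lipschitz map has coordinate differences at most \<open>2 * C\<close> box widths and
  \<open>2 * C * m\<close> box heights. The next number bounds how many boxes such an image meets,
  uniformly in \<open>l\<close>.
\<close>

definition box_distortion :: "nat \<Rightarrow> real \<Rightarrow> nat" where
  "box_distortion m C = (2 * nat \<lceil>2 * C * m\<rceil> + 3) ^ 2"

lemma card_grid_lipschitz:
  assumes "2 \<le> m" "m < n" "C > 0"
    and lip: "\<And>x y. x \<in> V \<Longrightarrow> y \<in> V \<Longrightarrow> dist (f x) (f y) \<le> C * dist x y"
    and fin: "finite (grid n m l ` V)"
  shows "card (grid n m l ` f ` V) \<le> card (grid n m l ` V) * box_distortion m C"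
proof -
  let ?P = "real (n ^ l)" and ?Q = "real (m ^ row_level n m l)" and ?T = "\<lceil>2 * C * m\<rceil> + 1"
  have P: "?P > 0" "?P \<le> ?Q" "?Q \<le> m * ?P"
    using row_level_bounds[OF assms(1,2), of l] assms(1,2) by (simp_all flip: of_nat_mult of_nat_power)
  let ?T2 = "{-?T..?T} \<times> {-?T..?T}"
  define rep where "rep = inv_into V (grid n m l)"
  \<comment> \<open>Images of points in one box lie in boxes whose indices differ by at most \<open>?T\<close>.\<close>
  have near: "grid n m l (f x) - grid n m l (f y) \<in> ?T2"
    if "x \<in> V" "y \<in> V" "grid n m l x = grid n m l y" for x y
  proof -
    have fl: "\<bar>a - b\<bar> < 1" if "\<lfloor>a\<rfloor> = \<lfloor>b\<rfloor>" for a b :: real using that by linarith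
    have "\<bar>?P * fst x - ?P * fst y\<bar> < 1" "\<bar>?Q * snd x - ?Q * snd y\<bar> < 1"
      using that(3) unfolding grid_def by (auto intro!: fl)
    then have "\<bar>?P * (fst x - fst y)\<bar> \<le> 1" "\<bar>?Q * (snd x - snd y)\<bar> \<le> 1"
      by (simp_all add: right_diff_distrib)
    then have a: "?P * \<bar>fst x - fst y\<bar> \<le> 1" and b: "?Q * \<bar>snd x - snd y\<bar> \<le> 1"
      using P by (simp_all add: abs_mult)
    have "?P * \<bar>snd x - snd y\<bar> \<le> 1"
      using b P(2) by (meson abs_ge_zero mult_right_mono order_trans)
    moreover have "dist x y \<le> \<bar>fst x - fst y\<bar> + \<bar>snd x - snd y\<bar>"
      unfolding dist_prod_def dist_real_def by (rule order_trans[OF sqrt_sum_squares_le_sum_abs]) simp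
    ultimately have "?P * dist x y \<le> ?P * (\<bar>fst x - fst y\<bar> + \<bar>snd x - snd y\<bar>)"
      and "?P * \<bar>snd x - snd y\<bar> \<le> 1"
      using P(1) by (auto intro: mult_left_mono)
    then have xy: "?P * dist x y \<le> 2" using a by (simp only: distrib_left)
    have "?P * dist (f x) (f y) \<le> ?P * (C * dist x y)"
      using lip[OF that(1,2)] P(1) by (intro mult_left_mono) auto
    also have "\<dots> = C * (?P * dist x y)" by simp
    also have "\<dots> \<le> C * 2" using xy assms(3) by (intro mult_left_mono) auto
    finally have d: "?P * dist (f x) (f y) \<le> 2 * C" by simp
    have cm: "2 * C \<le> 2 * C * m" using assms by simp
    have "?Q * dist (f x) (f y) \<le> m * (?P * dist (f x) (f y))"
      using P(3) by (metis mult.assoc mult_right_mono zero_le_dist)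
    also have "\<dots> \<le> m * (2 * C)" using d by (intro mult_left_mono) auto
    finally have e: "?Q * dist (f x) (f y) \<le> 2 * C * m" by (simp add: mult.commute)
    have "\<bar>?P * fst (f x) - ?P * fst (f y)\<bar> \<le> 2 * C * m"
    proof -
      have "\<bar>?P * fst (f x) - ?P * fst (f y)\<bar> = ?P * dist (fst (f x)) (fst (f y))"
        using P(1) by (simp add: dist_real_def abs_mult flip: right_diff_distrib)
      also have "\<dots> \<le> ?P * dist (f x) (f y)" using P(1) by (intro mult_left_mono dist_fst_le) auto
      finally show ?thesis using d cm by linarith
    qed
    moreover have "\<bar>?Q * snd (f x) - ?Q * snd (f y)\<bar> \<le> 2 * C * m"
    proof -
      have "\<bar>?Q * snd (f x) - ?Q * snd (f y)\<bar> = ?Q * dist (snd (f x)) (snd (f y))"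
        using P(1,2) by (simp add: dist_real_def abs_mult flip: right_diff_distrib)
      also have "\<dots> \<le> ?Q * dist (f x) (f y)" using P(1,2) by (intro mult_left_mono dist_snd_le) auto
      finally show ?thesis using e by linarith
    qed
    moreover have "\<lfloor>a\<rfloor> - \<lfloor>b\<rfloor> \<in> {-(\<lceil>c\<rceil> + 1)..\<lceil>c\<rceil> + 1}" if "\<bar>a - b\<bar> \<le> c" for a b c :: real
      using that by simp linarith
    ultimately show ?thesis unfolding grid_def by simp
  qed
  have T: "finite ?T2" "card ?T2 = (2 * nat \<lceil>2 * C * m\<rceil> + 3) ^ 2"
  proof -
    have "\<lceil>2 * C * m\<rceil> \<ge> 0" using assms by (simp add: ceiling_mono[of 0, simplified])
    then have "nat (?T - - ?T + 1) = 2 * nat \<lceil>2 * C * m\<rceil> + 3" by linarith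
    then show "card ?T2 = (2 * nat \<lceil>2 * C * m\<rceil> + 3) ^ 2"
      by (simp only: card_cartesian_product card_atLeastAtMost_int power2_eq_square)
  qed simp
  have ex: "\<exists>c\<in>grid n m l ` V. g - grid n m l (f (rep c)) \<in> ?T2" if g: "g \<in> grid n m l ` f ` V" for g
  proof -
    obtain z where z: "z \<in> V" "g = grid n m l (f z)" using g by blast
    have "rep (grid n m l z) \<in> V" "grid n m l (rep (grid n m l z)) = grid n m l z"
      unfolding rep_def using z(1) by (auto intro: inv_into_into f_inv_into_f)
    then have "g - grid n m l (f (rep (grid n m l z))) \<in> ?T2"
      unfolding z(2) by (intro near[OF z(1)]) simp_all
    then show ?thesis by (rule bexI) (use z(1) in simp)
  qed
  from card_le_translates[where h = "\<lambda>c. grid n m l (f (rep c))", OF fin T(1) ex]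
  show ?thesis unfolding T(2) box_distortion_def by auto
qed

section \<open>Box counts and the uniform Bernoulli measure\<close>

locale bernoulli_carpet =
  fixes n m :: nat and D :: "(nat \<times> nat) set" and E :: "(real \<times> real) set"
    and \<mu> :: "(real \<times> real) measure"
  assumes m2: "2 \<le> m" and mn: "m < n"
    and digits: "digit_set n m D" and carpet: "is_carpet n m D E"
    and bernoulli: "is_uniform_bernoulli n m D E \<mu>"
begin

text \<open>
  Digits pair a column with a row: the second components of the words of length \<open>r\<close> are the
  vertical words. They decide which boxes are met below the scale \<open>n\<^sup>-\<^sup>l\<close>, where the
  columns are no longer resolved.
\<close>

abbreviation "words \<equiv> digit_power n m D"

abbreviation "row_words r \<equiv> snd ` words r"

text \<open>
  The number of approximate squares of the carpet at level \<open>l\<close>: a full word of length \<open>l\<close> fixes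
  the column of a box, the vertical word after it the rest of its row.
\<close>

definition squares :: "nat \<Rightarrow> nat" where
  "squares l = card D ^ l * card (row_words (row_level n m l - l))"

lemma words_digits: "digit_set (n ^ p) (m ^ p) (words p)"
proof (induction p)
  case 0
  show ?case by (simp add: digit_set_def)
next
  case (Suc p)
  from digit_set_prod[OF this digits] show ?case by (simp add: mult.commute)
qed

lemma words_carpet: "is_carpet (n ^ p) (m ^ p) (words p) E"
proof (induction p)
  case 0
  show ?case using carpet by (simp add: is_carpet_def carpet_map_def)
next
  case (Suc p)
  from is_carpet_prod[OF _ _ this carpet] show ?case using m2 mn by (simp add: mult.commute)
qed

lemma words_bernoulli: "is_uniform_bernoulli (n ^ p) (m ^ p) (words p) E \<mu>"
proof (induction p)
  case 0
  have "A \<inter> E = A" if "A \<in> sets \<mu>" for A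
    using sets.sets_into_space[OF that] uniform_bernoulli_space[OF bernoulli] by auto
  moreover have "carpet_map 1 1 (0, 0) -` A = A" for A by (auto simp: carpet_map_def)
  ultimately show ?case using bernoulli uniform_bernoulli_space[OF bernoulli]
    by (simp add: is_uniform_bernoulli_def)
next
  case (Suc p)
  from uniform_bernoulli_prod[OF _ _ digits words_carpet carpet this bernoulli]
  show ?case using m2 mn by (simp add: mult.commute)
qed

lemma card_words: "card (words p) = card D ^ p"
  using digits by (induction p) (auto simp: card_digit_prod digit_set_def)

lemma card_D_pos: "card D > 0"
  using digits digit_set_finite[OF digits] by (auto simp: digit_set_def card_gt_0_iff)

lemma squares_pos: "squares l > 0"
  using words_digits[of "row_level n m l - l"] digit_set_finite[OF words_digits] card_D_pos
  by (auto simp: squares_def card_gt_0_iff digit_set_def)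

lemma space_eq: "space \<mu> = E" and sets_eq: "sets \<mu> = sets (restrict_space borel E)"
  and prob: "prob_space \<mu>"
  using bernoulli uniform_bernoulli_space[OF bernoulli] by (auto simp: is_uniform_bernoulli_def)

text \<open>
  If a coordinate \<open>g\<close> is maximal on the compact carpet at \<open>s\<close>, then \<open>s\<close> is the image of a point
  with a value at most \<open>g s\<close>, so \<open>k * g s \<le> g s + (k - 1)\<close>; the minimum is
  treated in the same way.
\<close>

lemma carpet_unit_square: "E \<subseteq> {0..1} \<times> {0..1}"
proof -
  have E: "E \<noteq> {}" "compact E" "E = (\<Union>d\<in>D. carpet_map n m d ` E)"
    using carpet by (auto simp: is_carpet_def)
  have key: "0 \<le> g z \<and> g z \<le> 1"
    if g: "continuous_on E g" and k: "2 \<le> k" and z: "z \<in> E"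
      and step: "\<And>z. z \<in> E \<Longrightarrow> \<exists>w\<in>E. \<exists>a<k. g z = (g w + real a) / real k"
    for g :: "real \<times> real \<Rightarrow> real" and k z
  proof -
    obtain s where s: "s \<in> E" "\<And>y. y \<in> E \<Longrightarrow> g y \<le> g s"
      using continuous_attains_sup[OF E(2,1) g] by blast
    obtain i where i: "i \<in> E" "\<And>y. y \<in> E \<Longrightarrow> g i \<le> g y"
      using continuous_attains_inf[OF E(2,1) g] by blast
    obtain w a where w: "w \<in> E" "a < k" "g s = (g w + real a) / real k" using step[OF s(1)] by blast
    have "real k * g s = g w + real a" using w k by simp
    also have "\<dots> \<le> g s + (real k - 1)" using s(2)[OF w(1)] w(2) by linarith
    finally have "(real k - 1) * g s \<le> (real k - 1) * 1" by (simp add: algebra_simps)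
    then have 1: "g s \<le> 1" using k by simp
    obtain w a where w: "w \<in> E" "a < k" "g i = (g w + real a) / real k" using step[OF i(1)] by blast
    have "real k * g i = g w + real a" using w k by simp
    then have "real k * g i \<ge> g i" using i(2)[OF w(1)] by linarith
    then have "(real k - 1) * g i \<ge> (real k - 1) * 0" by (simp add: algebra_simps)
    then have "g i \<ge> 0" using k by (simp add: zero_le_mult_iff)
    with 1 s(2)[OF z] i(2)[OF z] show ?thesis by linarith
  qed
  have "z \<in> {0..1} \<times> {0..1}" if z: "z \<in> E" for z
  proof -
    have st: "\<exists>w\<in>E. \<exists>d\<in>D. z = carpet_map n m d w" if "z \<in> E" for z using E(3) that by blast
    have "0 \<le> fst z \<and> fst z \<le> 1"
    proof (rule key[OF _ _ z, of _ n])
      fix z assume "z \<in> E"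
      from st[OF this] show "\<exists>w\<in>E. \<exists>a<n. fst z = (fst w + real a) / real n"
        using digits by (fastforce simp: digit_set_def carpet_map_def)
    qed (use m2 mn in \<open>auto intro: continuous_intros\<close>)
    moreover have "0 \<le> snd z \<and> snd z \<le> 1"
    proof (rule key[OF _ _ z, of _ m])
      fix z assume "z \<in> E"
      from st[OF this] show "\<exists>w\<in>E. \<exists>a<m. snd z = (snd w + real a) / real m"
        using digits by (fastforce simp: digit_set_def carpet_map_def)
    qed (use m2 in \<open>auto intro: continuous_intros\<close>)
    ultimately show ?thesis by (auto simp: mem_Times_iff)
  qed
  then show ?thesis by blast
qed

lemma carpet_coordinates:
  assumes "z \<in> E"
  shows "0 \<le> fst z" "fst z \<le> 1" "0 \<le> snd z" "snd z \<le> 1"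
  using carpet_unit_square assms by (auto simp: mem_Times_iff)

text \<open>
  The lower left corners, in grid coordinates, of the boxes of level \<open>l\<close> that belong to the
  cylinders of rank \<open>p\<close> indexed by \<open>W\<close>: each word of \<open>W\<close> is continued by \<open>l - p\<close> full digits and
  then by vertical digits only, which multiply the column index by \<open>1\<close>.
\<close>

definition cells :: "nat \<Rightarrow> nat \<Rightarrow> (nat \<times> nat) set \<Rightarrow> (nat \<times> nat) set" where
  "cells l p W = digit_prod 1 (m ^ (row_level n m l - l))
     (digit_prod (n ^ (l - p)) (m ^ (l - p)) W (words (l - p))) ({0} \<times> row_words (row_level n m l - l))"

lemma row_words_less: "row_words r \<subseteq> {0..<m ^ r}"
  using words_digits[of r] by (auto simp: digit_set_def)

lemma card_cells:
  assumes "p \<le> l"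
  shows "card (cells l p W) * card D ^ p = card W * squares l"
proof -
  have "{0::nat} \<times> row_words r \<subseteq> {0..<1} \<times> {0..<m ^ r}" for r using row_words_less[of r] by auto
  moreover have "words q \<subseteq> {0..<n ^ q} \<times> {0..<m ^ q}" for q
    using words_digits[of q] by (simp add: digit_set_def)
  ultimately have "card (cells l p W) = card W * card D ^ (l - p) * card (row_words (row_level n m l - l))"
    unfolding cells_def by (simp add: card_digit_prod card_words card_cartesian_product_singleton)
  moreover have "card D ^ l = card D ^ (l - p) * card D ^ p" using assms by (simp flip: power_add)
  ultimately show ?thesis by (simp add: squares_def)
qed

lemma finite_cells: "finite W \<Longrightarrow> finite (cells l p W)"
  using digit_set_finite[OF words_digits] by (auto simp: cells_def digit_prod_def)

lemma cell_coordinates: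
  assumes "p \<le> l" and z: "z = carpet_map (n ^ p) (m ^ p) w (carpet_map (n ^ (l - p)) (m ^ (l - p)) u e)"
    and e: "e = carpet_map (n ^ r) (m ^ r) v e'" and r: "row_level n m l = l + r"
  shows "real (n ^ l) * fst z = real (fst w * n ^ (l - p) + fst u) + fst e"
    and "real (m ^ row_level n m l) * snd z =
           real ((snd w * m ^ (l - p) + snd u) * m ^ r + snd v) + snd e'"
proof -
  have l: "n ^ l = n ^ p * n ^ (l - p)" "m ^ l = m ^ p * m ^ (l - p)"
    using assms(1) by (simp_all flip: power_add)
  show "real (n ^ l) * fst z = real (fst w * n ^ (l - p) + fst u) + fst e"
    unfolding z l(1) using m2 mn by (simp add: carpet_map_def field_simps)
  show "real (m ^ row_level n m l) * snd z =
           real ((snd w * m ^ (l - p) + snd u) * m ^ r + snd v) + snd e'"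
    unfolding z e r power_add l(2) using m2 by (simp add: carpet_map_def field_simps)
qed

definition cylinders :: "nat \<Rightarrow> (nat \<times> nat) set \<Rightarrow> (real \<times> real) set" where
  "cylinders p W = (\<Union>w\<in>W. carpet_map (n ^ p) (m ^ p) w ` E)"

lemma floor_near_unit: "0 \<le> t \<Longrightarrow> t \<le> 1 \<Longrightarrow> \<lfloor>real a + t\<rfloor> - int a \<in> {0..1}"
  by simp

text \<open>
  The grid box of a point of the carpet may differ from the cell of its digit expansion by one in each
  coordinate, since an expansion ending in maximal digits denotes a point on the upper or
  right edge of its cell.
\<close>

lemma grid_cylinders_in_cells:
  assumes "p \<le> l" "z \<in> cylinders p W"
  shows "\<exists>c\<in>cells l p W. grid n m l z - (int (fst c), int (snd c)) \<in> {0..1} \<times> {0..1}"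
proof -
  define r where "r = row_level n m l - l"
  have r: "row_level n m l = l + r" using row_level_bounds(3)[OF m2 mn, of l] by (simp add: r_def)
  obtain w z1 where w: "w \<in> W" "z1 \<in> E" "z = carpet_map (n ^ p) (m ^ p) w z1"
    using assms(2) by (auto simp: cylinders_def)
  obtain u e where u: "u \<in> words (l - p)" "e \<in> E" "z1 = carpet_map (n ^ (l - p)) (m ^ (l - p)) u e"
    using words_carpet[of "l - p"] w(2) unfolding is_carpet_def by blast
  obtain v e' where v: "v \<in> words r" "e' \<in> E" "e = carpet_map (n ^ r) (m ^ r) v e'"
    using words_carpet[of r] u(2) unfolding is_carpet_def by blast
  note co = cell_coordinates[OF assms(1) w(3)[unfolded u(3)] v(3) r]
  let ?c = "(fst w * n ^ (l - p) + fst u, (snd w * m ^ (l - p) + snd u) * m ^ r + snd v)"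
  have "(0, snd v) \<in> {0} \<times> row_words r" using v(1) by simp
  from digit_prodI[OF digit_prodI[OF w(1) u(1), of "n ^ (l - p)" "m ^ (l - p)"] this, of 1 "m ^ r"]
  have "?c \<in> cells l p W"
    unfolding cells_def r_def[symmetric] by simp
  moreover have "grid n m l z - (int (fst ?c), int (snd ?c)) \<in> {0..1} \<times> {0..1}"
    using floor_near_unit[OF carpet_coordinates(1,2)[OF u(2)]]
      floor_near_unit[OF carpet_coordinates(3,4)[OF v(2)]]
    by (simp only: grid_def co mem_Times_iff fst_diff snd_diff fst_conv snd_conv)
  ultimately show ?thesis by (rule bexI[rotated])
qed

lemma cells_in_grid_cylinders:
  assumes "p \<le> l" "c \<in> cells l p W"
  shows "\<exists>z\<in>cylinders p W. grid n m l z - (int (fst c), int (snd c)) \<in> {0..1} \<times> {0..1}"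
proof -
  define r where "r = row_level n m l - l"
  have r: "row_level n m l = l + r" using row_level_bounds(3)[OF m2 mn, of l] by (simp add: r_def)
  obtain w u v where wuv: "w \<in> W" "u \<in> words (l - p)" "v \<in> words r"
    and c: "c = (fst w * n ^ (l - p) + fst u, (snd w * m ^ (l - p) + snd u) * m ^ r + snd v)"
    using assms(2) unfolding cells_def digit_prod_def r_def[symmetric] by auto
  obtain e' where e': "e' \<in> E" using carpet by (auto simp: is_carpet_def)
  define e where "e = carpet_map (n ^ r) (m ^ r) v e'"
  define z1 where "z1 = carpet_map (n ^ (l - p)) (m ^ (l - p)) u e"
  define z where "z = carpet_map (n ^ p) (m ^ p) w z1"
  have e: "e \<in> E" unfolding e_def by (rule is_carpet_map_in[OF words_carpet wuv(3) e'])
  have "z1 \<in> E" unfolding z1_def by (rule is_carpet_map_in[OF words_carpet wuv(2) e])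
  then have "z \<in> cylinders p W" using wuv(1) by (auto simp: z_def cylinders_def)
  moreover have "grid n m l z - (int (fst c), int (snd c)) \<in> {0..1} \<times> {0..1}"
    using floor_near_unit[OF carpet_coordinates(1,2)[OF e]]
      floor_near_unit[OF carpet_coordinates(3,4)[OF e']]
    by (simp only: grid_def c cell_coordinates[OF assms(1) z_def[unfolded z1_def] e_def r]
        mem_Times_iff fst_diff snd_diff fst_conv snd_conv)
  ultimately show ?thesis by (rule bexI[rotated])
qed

text \<open>
  Cells and grid boxes correspond up to a shift in \<open>{0..1} \<times> {0..1}\<close>, so each family is at most four
  times the other. The factor \<open>card D ^ p\<close> is kept on the other side to stay within the
  natural numbers.
\<close>

lemma card_grid_cylinders:
  assumes "p \<le> l" "finite W"
  shows "finite (grid n m l ` cylinders p W)"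
    and "card (grid n m l ` cylinders p W) * card D ^ p \<le> 4 * card W * squares l"
    and "card W * squares l \<le> 4 * card (grid n m l ` cylinders p W) * card D ^ p"
proof -
  let ?G = "grid n m l ` cylinders p W" and ?C = "cells l p W"
  have "\<exists>c\<in>?C. g - (int (fst c), int (snd c)) \<in> {0..1} \<times> {0..1}" if "g \<in> ?G" for g
    using that grid_cylinders_in_cells[OF assms(1)] by auto
  from card_le_translates[OF finite_cells[OF assms(2)] _ this]
  have fin: "finite ?G" and up: "card ?G \<le> card ?C * 4" by (simp_all add: card_cartesian_product)
  show "finite ?G" by (fact fin)
  have "card ?G * card D ^ p \<le> card ?C * 4 * card D ^ p" using up by (rule mult_right_mono) simp
  also have "\<dots> = 4 * (card ?C * card D ^ p)" by simp
  finally show "card ?G * card D ^ p \<le> 4 * card W * squares l"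
    unfolding card_cells[OF assms(1)] by simp
  let ?C' = "(\<lambda>c. (int (fst c), int (snd c))) ` ?C"
  have "card ?C' = card ?C" by (rule card_image) (auto simp: inj_on_def prod_eq_iff)
  moreover have "\<exists>g\<in>?G. c - g \<in> {-1..0} \<times> {-1..0}" if "c \<in> ?C'" for c
    using that cells_in_grid_cylinders[OF assms(1)] by (force simp: mem_Times_iff)
  from card_le_translates(2)[where h = "\<lambda>x. x", OF fin _ this]
  have "card ?C' \<le> card ?G * 4" by (simp add: card_cartesian_product)
  ultimately have "card ?C * card D ^ p \<le> card ?G * 4 * card D ^ p"
    by (intro mult_right_mono) auto
  then show "card W * squares l \<le> 4 * card ?G * card D ^ p"
    unfolding card_cells[OF assms(1)] by (simp add: mult.commute)
qed

lemma cylinders_all: "cylinders 0 (words 0) = E"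
  by (simp add: cylinders_def carpet_map_def)

lemma finite_grid:
  assumes "A \<subseteq> E"
  shows "finite (grid n m l ` A)"
proof -
  have "finite (grid n m l ` E)"
    using card_grid_cylinders(1)[of 0 l "words 0"] unfolding cylinders_all by simp
  then show ?thesis using image_mono[OF assms] by (rule finite_subset[rotated])
qed

lemma cylinder_small:
  assumes "\<epsilon> > 0"
  obtains p where "\<And>w x y. x \<in> carpet_map (n ^ p) (m ^ p) w ` E \<Longrightarrow>
    y \<in> carpet_map (n ^ p) (m ^ p) w ` E \<Longrightarrow> dist x y < \<epsilon>"
proof -
  have "1 / real m < 1" using m2 by simp
  then obtain p where p: "(1 / real m) ^ p < \<epsilon> / 2"
    using real_arch_pow_inv[of "\<epsilon> / 2" "1 / real m"] assms by auto
  have mp: "real m ^ p > 0" "real m ^ p \<le> real n ^ p" using m2 mn by (auto intro: power_mono)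
  have "dist (carpet_map (n ^ p) (m ^ p) w x) (carpet_map (n ^ p) (m ^ p) w y) < \<epsilon>"
    if "x \<in> E" "y \<in> E" for w x y
  proof -
    have b: "\<bar>fst x - fst y\<bar> \<le> 1" "\<bar>snd x - snd y\<bar> \<le> 1"
      using carpet_coordinates[OF \<open>x \<in> E\<close>] carpet_coordinates[OF \<open>y \<in> E\<close>] by linarith+
    let ?X = "carpet_map (n ^ p) (m ^ p) w x" and ?Y = "carpet_map (n ^ p) (m ^ p) w y"
    have "fst ?X - fst ?Y = (fst x - fst y) / real n ^ p"
      "snd ?X - snd ?Y = (snd x - snd y) / real m ^ p"
      by (simp_all add: carpet_map_def diff_divide_distrib add_divide_distrib)
    then have 1: "\<bar>fst ?X - fst ?Y\<bar> \<le> 1 / real m ^ p" "\<bar>snd ?X - snd ?Y\<bar> \<le> 1 / real m ^ p"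
      using b mp by (auto simp: abs_divide intro!: frac_le divide_right_mono)
    have "dist ?X ?Y \<le> \<bar>fst ?X - fst ?Y\<bar> + \<bar>snd ?X - snd ?Y\<bar>"
      unfolding dist_prod_def dist_real_def by (rule order_trans[OF sqrt_sum_squares_le_sum_abs]) simp
    with 1 p show ?thesis by (simp add: power_divide)
  qed
  then show ?thesis by (intro that[of p]) auto
qed

lemma measure_words:
  assumes "A \<in> sets \<mu>"
  shows "real (card D) ^ p * measure \<mu> A =
    (\<Sum>w\<in>words p. measure \<mu> (carpet_map (n ^ p) (m ^ p) w -` A \<inter> E))"
proof -
  have "measure \<mu> A = (\<Sum>w\<in>words p. 1 / real (card (words p)) *
      measure \<mu> (carpet_map (n ^ p) (m ^ p) w -` A \<inter> E))"
    using words_bernoulli[of p] assms unfolding is_uniform_bernoulli_def space_eq by auto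
  then show ?thesis using card_D_pos by (simp add: card_words flip: sum_divide_distrib)
qed

text \<open>
  The link between measure and box counting. Take \<open>p\<close> so large that cylinders of rank \<open>p\<close>
  have diameter below \<open>\<epsilon>\<close>, and let \<open>W\<close> index those meeting \<open>A\<close>; they cover \<open>A\<close> and lie in \<open>U\<close>. By
  self-similarity each word of \<open>W\<close> contributes its full weight to \<open>\<mu> U\<close>, while only words of
  \<open>W\<close> contribute to \<open>\<mu> A\<close>. Words are weighed here, not sets, so overlaps of
  cylinders do no harm.
\<close>

lemma neighbourhood_box_count:
  assumes "\<epsilon> > 0" "A \<subseteq> E" and nbh: "\<And>a z. a \<in> A \<Longrightarrow> z \<in> E \<Longrightarrow> dist a z < \<epsilon> \<Longrightarrow> z \<in> U"
  obtains p where
    "\<And>l. p \<le> l \<Longrightarrow> U \<in> sets \<mu> \<Longrightarrow> card (grid n m l ` A) \<le> 4 * squares l * measure \<mu> U"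
    "\<And>l. p \<le> l \<Longrightarrow> A \<in> sets \<mu> \<Longrightarrow> U \<subseteq> E \<Longrightarrow>
      squares l * measure \<mu> A \<le> 4 * card (grid n m l ` U)"
proof -
  interpret prob_space \<mu> by (rule prob)
  obtain p where p: "\<And>w x y. x \<in> carpet_map (n ^ p) (m ^ p) w ` E \<Longrightarrow>
    y \<in> carpet_map (n ^ p) (m ^ p) w ` E \<Longrightarrow> dist x y < \<epsilon>"
    using cylinder_small[OF assms(1)] by blast
  define W where "W = {w \<in> words p. carpet_map (n ^ p) (m ^ p) w ` E \<inter> A \<noteq> {}}"
  have fw: "finite (words p)" by (rule digit_set_finite[OF words_digits])
  have fW: "finite W" using fw by (simp add: W_def)
  have inE: "carpet_map (n ^ p) (m ^ p) w ` E \<subseteq> E" if "w \<in> words p" for w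
    using is_carpet_map_in[OF words_carpet that] by auto
  have WU: "carpet_map (n ^ p) (m ^ p) w ` E \<subseteq> U" if w: "w \<in> W" for w
  proof
    fix z assume z: "z \<in> carpet_map (n ^ p) (m ^ p) w ` E"
    obtain a where a: "a \<in> A" "a \<in> carpet_map (n ^ p) (m ^ p) w ` E" using w by (auto simp: W_def)
    have "w \<in> words p" using w by (simp add: W_def)
    then have "z \<in> E" using inE z by blast
    then show "z \<in> U" by (rule nbh[OF a(1) _ p[OF a(2) z]])
  qed
  have AW: "A \<subseteq> cylinders p W"
    using assms(2) words_carpet[of p] unfolding is_carpet_def cylinders_def W_def by blast
  have cU: "cylinders p W \<subseteq> U" using WU by (auto simp: cylinders_def)
  have N: "real (card D) ^ p > 0" using card_D_pos by simp
  show ?thesis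
  proof (rule that[of p])
    fix l assume l: "p \<le> l" and U: "U \<in> sets \<mu>"
    have "real (card W) = (\<Sum>w\<in>W. measure \<mu> (carpet_map (n ^ p) (m ^ p) w -` U \<inter> E))"
    proof -
      have "carpet_map (n ^ p) (m ^ p) w -` U \<inter> E = space \<mu>" if "w \<in> W" for w
        using WU[OF that] unfolding space_eq by auto
      then show ?thesis by (simp add: prob_space)
    qed
    also have "\<dots> \<le> (\<Sum>w\<in>words p. measure \<mu> (carpet_map (n ^ p) (m ^ p) w -` U \<inter> E))"
      using fw by (intro sum_mono2) (auto simp: W_def)
    finally have W: "real (card W) \<le> real (card D) ^ p * measure \<mu> U" using measure_words[OF U] by simp
    have "card (grid n m l ` A) \<le> card (grid n m l ` cylinders p W)"
      using AW card_grid_cylinders(1)[OF l fW] by (intro card_mono) auto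
    then have "card (grid n m l ` A) * card D ^ p \<le> 4 * card W * squares l"
      using card_grid_cylinders(2)[OF l fW] by (meson mult_le_mono1 order_trans)
    then have "real (card (grid n m l ` A) * card D ^ p) \<le> real (4 * card W * squares l)"
      by (rule of_nat_mono)
    then have "card (grid n m l ` A) * real (card D) ^ p \<le> 4 * squares l * real (card W)"
      by (simp add: mult_ac)
    also have "\<dots> \<le> 4 * squares l * (real (card D) ^ p * measure \<mu> U)"
      using W by (intro mult_left_mono) auto
    finally have "card (grid n m l ` A) * real (card D) ^ p
      \<le> (4 * squares l * measure \<mu> U) * real (card D) ^ p" by (simp add: mult_ac)
    then show "card (grid n m l ` A) \<le> 4 * squares l * measure \<mu> U" using N by simp
  next
    fix l assume l: "p \<le> l" and A: "A \<in> sets \<mu>" and U: "U \<subseteq> E"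
    have "real (card D) ^ p * measure \<mu> A =
        (\<Sum>w\<in>W. measure \<mu> (carpet_map (n ^ p) (m ^ p) w -` A \<inter> E))"
      unfolding measure_words[OF A]
    proof (rule sum.mono_neutral_right[OF fw])
      show "W \<subseteq> words p" by (auto simp: W_def)
      show "\<forall>w\<in>words p - W. measure \<mu> (carpet_map (n ^ p) (m ^ p) w -` A \<inter> E) = 0"
      proof
        fix w assume "w \<in> words p - W"
        then have "carpet_map (n ^ p) (m ^ p) w -` A \<inter> E = {}" by (auto simp: W_def)
        then show "measure \<mu> (carpet_map (n ^ p) (m ^ p) w -` A \<inter> E) = 0" by simp
      qed
    qed
    also have "\<dots> \<le> real (card W) * 1" by (intro sum_bounded_above prob_le_1)
    finally have W: "real (card D) ^ p * measure \<mu> A \<le> card W" by simp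
    have "card (grid n m l ` cylinders p W) \<le> card (grid n m l ` U)"
      using cU finite_grid[OF U] by (intro card_mono) auto
    then have "card W * squares l \<le> 4 * card (grid n m l ` U) * card D ^ p"
      using card_grid_cylinders(3)[OF l fW]
      by (meson mult_le_mono1 mult_le_mono2 order_trans)
    then have c: "real (card W * squares l) \<le> real (4 * card (grid n m l ` U) * card D ^ p)"
      by (rule of_nat_mono)
    have "(squares l * measure \<mu> A) * real (card D) ^ p = (real (card D) ^ p * measure \<mu> A) * squares l"
      by (simp add: mult_ac)
    also have "\<dots> \<le> real (card W) * squares l" using W by (intro mult_right_mono) auto
    also have "\<dots> \<le> (4 * card (grid n m l ` U)) * real (card D) ^ p" using c by simp
    finally show "squares l * measure \<mu> A \<le> 4 * card (grid n m l ` U)" using N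
      by (simp only: mult_le_cancel_right_pos)
  qed
qed

lemma card_grid_carpet:
  shows "card (grid n m l ` E) \<le> 4 * squares l" "squares l \<le> 4 * card (grid n m l ` E)"
  using card_grid_cylinders(2,3)[of 0 l "words 0"] unfolding cylinders_all by auto

lemma closed_carpet: "closed E"
  using carpet by (auto simp: is_carpet_def compact_imp_closed)

lemma sets_iff: "A \<in> sets \<mu> \<longleftrightarrow> A \<in> sets borel \<and> A \<subseteq> E"
  unfolding sets_eq using closed_carpet by (auto simp: sets_restrict_space_iff)

lemma regular:
  assumes "A \<in> sets \<mu>" "\<epsilon> > 0"
  shows "\<exists>K. compact K \<and> K \<subseteq> A \<and> measure \<mu> A \<le> measure \<mu> K + \<epsilon>"
    and "\<exists>U. open U \<and> A \<subseteq> U \<and> measure \<mu> (U \<inter> E) \<le> measure \<mu> A + \<epsilon>"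
proof -
  interpret prob_space \<mu> by (rule prob)
  define \<nu> where "\<nu> = distr \<mu> borel (\<lambda>x. x)"
  have id: "(\<lambda>x. x) \<in> measurable \<mu> borel"
    by (rule measurableI) (auto simp: sets_iff space_eq closed_carpet)
  interpret \<nu>: prob_space \<nu> unfolding \<nu>_def by (rule prob_space_distr[OF id])
  have m: "measure \<nu> B = measure \<mu> (B \<inter> E)" if "B \<in> sets borel" for B
    using measure_distr[OF id that] by (simp add: \<nu>_def space_eq)
  have e: "emeasure \<nu> B = ennreal (measure \<mu> (B \<inter> E))" if "B \<in> sets borel" for B
    using m[OF that] by (simp add: \<nu>.emeasure_eq_measure)
  have s: "sets \<nu> = sets borel" by (simp add: \<nu>_def)
  have fin: "emeasure \<nu> (space \<nu>) \<noteq> \<infinity>" by simp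
  have A: "A \<in> sets borel" "A \<subseteq> E" "A \<inter> E = A" using assms(1) by (auto simp: sets_iff)
  show "\<exists>K. compact K \<and> K \<subseteq> A \<and> measure \<mu> A \<le> measure \<mu> K + \<epsilon>"
  proof (cases "measure \<mu> A \<le> \<epsilon>")
    case True
    then show ?thesis by (intro exI[of _ "{}"]) auto
  next
    case False
    have "ennreal (measure \<mu> A - \<epsilon>) < emeasure \<nu> A"
      using False assms(2) by (simp add: e[OF A(1)] A(3) ennreal_less_iff)
    also have "\<dots> = (SUP K\<in>{K. K \<subseteq> A \<and> compact K}. emeasure \<nu> K)"
      by (rule inner_regular[OF s fin A(1)])
    finally obtain K where K: "K \<subseteq> A" "compact K" "ennreal (measure \<mu> A - \<epsilon>) < emeasure \<nu> K"
      by (auto simp: less_SUP_iff)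
    have "K \<inter> E = K" "K \<in> sets borel" using K A by (auto intro: borel_compact)
    with K(3) False have "measure \<mu> A - \<epsilon> < measure \<mu> K" by (simp add: e ennreal_less_iff)
    with K show ?thesis by (intro exI[of _ K]) auto
  qed
  have "(INF U\<in>{U. A \<subseteq> U \<and> open U}. emeasure \<nu> U) = emeasure \<nu> A"
    by (rule outer_regular[OF s fin A(1), symmetric])
  also have "\<dots> < ennreal (measure \<mu> A + \<epsilon>)"
    using assms(2) by (simp add: e[OF A(1)] A(3) ennreal_less_iff)
  finally obtain U where U: "A \<subseteq> U" "open U" "emeasure \<nu> U < ennreal (measure \<mu> A + \<epsilon>)"
    by (auto simp: INF_less_iff)
  then have "measure \<mu> (U \<inter> E) < measure \<mu> A + \<epsilon>" by (simp add: e ennreal_less_iff)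
  with U show "\<exists>U. open U \<and> A \<subseteq> U \<and> measure \<mu> (U \<inter> E) \<le> measure \<mu> A + \<epsilon>"
    by (intro exI[of _ U]) auto
qed

end

section \<open>Bi-Lipschitz images\<close>

text \<open>
  Of the factor \<open>256\<close>, one \<open>4\<close> comes from each of the four comparisons between measures or
  total counts and boxes; the distortion enters once through \<open>f\<close> and once through the inverse \<open>g\<close>,
  which is used to compare the total box counts.
\<close>

lemma bilipschitz_measure_le_neighbourhood:
  assumes "bernoulli_carpet n m D E \<mu>" "bernoulli_carpet n m D' F \<nu>"
    and C: "C > 0" and fE: "f ` E = F" and gF: "\<And>x. x \<in> E \<Longrightarrow> g (f x) = x"
    and f: "\<And>x y. x \<in> E \<Longrightarrow> y \<in> E \<Longrightarrow> dist (f x) (f y) \<le> C * dist x y"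
    and g: "\<And>x y. x \<in> F \<Longrightarrow> y \<in> F \<Longrightarrow> dist (g x) (g y) \<le> C * dist x y"
    and K: "K \<subseteq> E" "f ` K \<in> sets \<nu>" and U: "U \<in> sets \<mu>"
    and \<epsilon>: "\<epsilon> > 0" "\<And>a z. a \<in> K \<Longrightarrow> z \<in> E \<Longrightarrow> dist a z < \<epsilon> \<Longrightarrow> z \<in> U"
  shows "measure \<nu> (f ` K) \<le> 256 * real (box_distortion m C) ^ 2 * measure \<mu> U"
proof -
  interpret E: bernoulli_carpet n m D E \<mu> by fact
  interpret F: bernoulli_carpet n m D' F \<nu> by fact
  define B where "B = box_distortion m C"
  \<comment> \<open>Half of \<open>\<epsilon>\<close> separates \<open>K\<close> from the complement of \<open>V\<close>, the other half \<open>V\<close> from that of \<open>U\<close>.\<close>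
  define V where "V = {z \<in> E. \<exists>a\<in>K. dist a z < \<epsilon> / 2}"
  have V: "V \<subseteq> E" by (auto simp: V_def)
  have VU: "z \<in> U" if "v \<in> V" "z \<in> E" "dist v z < \<epsilon> / 2" for v z
  proof -
    obtain a where a: "a \<in> K" "dist a v < \<epsilon> / 2" using \<open>v \<in> V\<close> by (auto simp: V_def)
    have "dist a z < \<epsilon>" using dist_triangle[of a z v] a(2) that(3) by linarith
    with \<epsilon>(2) a that show ?thesis by blast
  qed
  obtain p where p: "\<And>l. p \<le> l \<Longrightarrow> card (grid n m l ` V) \<le> 4 * E.squares l * measure \<mu> U"
    by (rule E.neighbourhood_box_count[OF half_gt_zero[OF \<epsilon>(1)] V VU]) (use U in auto)
  have KV: "z \<in> f ` V" if aK: "a \<in> f ` K" and zF: "z \<in> F" and az: "dist a z < \<epsilon> / (2 * C)" for a z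
  proof -
    obtain a' z' where a': "a' \<in> K" "a = f a'" and z': "z' \<in> E" "z = f z'" using aK zF fE by blast
    have a'E: "a' \<in> E" using a' K by auto
    then have "a \<in> F" using a' fE by auto
    have "dist a' z' \<le> C * dist a z"
      using g[OF \<open>a \<in> F\<close> zF] a' z' gF[OF a'E] gF[OF z'(1)] by simp
    also have "\<dots> < C * (\<epsilon> / (2 * C))" using az C by (intro mult_strict_left_mono)
    also have "\<dots> = \<epsilon> / 2" using C by simp
    finally show ?thesis using a' z' by (auto simp: V_def)
  qed
  have fV: "f ` V \<subseteq> F" "f ` K \<subseteq> F" using V K fE by auto
  have "\<epsilon> / (2 * C) > 0" using \<epsilon>(1) C by simp
  then obtain p' where
    p': "\<And>l. p' \<le> l \<Longrightarrow> F.squares l * measure \<nu> (f ` K) \<le> 4 * card (grid n m l ` f ` V)"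
    by (rule F.neighbourhood_box_count[OF _ fV(2) KV]) (use K(2) fV(1) in auto)
  define l where "l = max p p'"
  have "g ` F = E" using gF by (simp add: image_image flip: fE)
  have "card (grid n m l ` g ` F) \<le> card (grid n m l ` F) * B"
    unfolding B_def by (rule card_grid_lipschitz[OF E.m2 E.mn C g F.finite_grid]) auto
  also have "\<dots> \<le> 4 * F.squares l * B" by (rule mult_right_mono[OF F.card_grid_carpet(1)]) simp
  finally have "E.squares l \<le> 16 * B * F.squares l"
    using E.card_grid_carpet(2)[of l] unfolding \<open>g ` F = E\<close> by (simp add: mult_ac)
  then have "real (E.squares l) \<le> real (16 * B * F.squares l)" by (rule of_nat_mono)
  then have EF: "real (E.squares l) \<le> 16 * B * F.squares l" by simp
  have "card (grid n m l ` f ` V) \<le> card (grid n m l ` V) * B"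
    unfolding B_def using V by (intro card_grid_lipschitz[OF E.m2 E.mn C f E.finite_grid[OF V]]) auto
  then have "real (card (grid n m l ` f ` V)) \<le> real (card (grid n m l ` V) * B)" by (rule of_nat_mono)
  then have fVB: "real (card (grid n m l ` f ` V)) \<le> card (grid n m l ` V) * B" by simp
  have "F.squares l * measure \<nu> (f ` K) \<le> 4 * (card (grid n m l ` V) * B)"
    using p'[of l] fVB by (simp add: l_def)
  also have "\<dots> \<le> 4 * (4 * E.squares l * measure \<mu> U * B)"
  proof -
    have "real (card (grid n m l ` V)) \<le> 4 * E.squares l * measure \<mu> U"
      by (rule p) (simp add: l_def)
    from mult_right_mono[OF this, of "real B"] show ?thesis by (simp add: mult_ac)
  qed
  also have "\<dots> = 16 * B * measure \<mu> U * E.squares l" by simp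
  also have "\<dots> \<le> 16 * B * measure \<mu> U * (16 * B * F.squares l)"
    using EF by (intro mult_left_mono) auto
  also have "\<dots> = F.squares l * (256 * real B ^ 2 * measure \<mu> U)" by (simp add: power2_eq_square)
  finally show ?thesis using F.squares_pos[of l] by (simp add: B_def)
qed

text \<open>
  Approximate the image of \<open>A\<close> from inside by a compact set and \<open>A\<close> from outside by an open set;
  the preimage of the former is a compact subset of the latter, hence at positive distance from
  its complement.
\<close>

lemma bilipschitz_measure_le:
  assumes E: "bernoulli_carpet n m D E \<mu>" and F: "bernoulli_carpet n m D' F \<nu>"
    and C: "C > 0" and fE: "f ` E = F" and gF: "\<And>x. x \<in> E \<Longrightarrow> g (f x) = x"
    and f: "\<And>x y. x \<in> E \<Longrightarrow> y \<in> E \<Longrightarrow> dist (f x) (f y) \<le> C * dist x y"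
    and g: "\<And>x y. x \<in> F \<Longrightarrow> y \<in> F \<Longrightarrow> dist (g x) (g y) \<le> C * dist x y"
    and A: "A \<in> sets \<mu>"
  shows "f ` A \<in> sets \<nu>"
    and "measure \<nu> (f ` A) \<le> 256 * real (box_distortion m C) ^ 2 * measure \<mu> A"
proof -
  interpret E: bernoulli_carpet n m D E \<mu> by fact
  interpret F: bernoulli_carpet n m D' F \<nu> by fact
  let ?c = "256 * real (box_distortion m C) ^ 2"
  have AE: "A \<subseteq> E" "A \<in> sets borel" using A by (auto simp: E.sets_iff)
  have cg: "continuous_on F g"
    using C by (intro lipschitz_on_continuous_on[of C] lipschitz_onI g) auto
  have "f ` A = g -` A \<inter> F"
  proof
    show "f ` A \<subseteq> g -` A \<inter> F" using AE gF by (auto simp flip: fE)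
    show "g -` A \<inter> F \<subseteq> f ` A" using gF by (auto simp flip: fE)
  qed
  moreover have "g -` A \<inter> space (restrict_space borel F) \<in> sets (restrict_space borel F)"
    by (rule measurable_sets[OF borel_measurable_continuous_on_restrict[OF cg] AE(2)])
  ultimately show fA: "f ` A \<in> sets \<nu>" by (simp add: F.sets_eq space_restrict_space)
  show "measure \<nu> (f ` A) \<le> ?c * measure \<mu> A"
  proof (rule field_le_epsilon)
    fix e :: real assume e: "e > 0"
    \<comment> \<open>The error \<open>\<epsilon>\<close> occurs once inside, and once outside with the factor \<open>?c\<close>.\<close>
    define \<epsilon> where "\<epsilon> = e / (?c + 1)"
    have c: "?c \<ge> 0" by simp
    have \<epsilon>: "\<epsilon> > 0" using e c by (simp add: \<epsilon>_def add_nonneg_pos)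
    obtain K' where K': "compact K'" "K' \<subseteq> f ` A" "measure \<nu> (f ` A) \<le> measure \<nu> K' + \<epsilon>"
      using F.regular(1)[OF fA \<epsilon>] by blast
    obtain U where U: "open U" "A \<subseteq> U" "measure \<mu> (U \<inter> E) \<le> measure \<mu> A + \<epsilon>"
      using E.regular(2)[OF A \<epsilon>] by blast
    have KF: "K' \<subseteq> F" using K'(2) AE fE by auto
    define K where "K = g ` K'"
    have K: "compact K" unfolding K_def
      by (rule compact_continuous_image[OF continuous_on_subset[OF cg KF] K'(1)])
    have fg: "f (g y) = y \<and> g y \<in> A" if y: "y \<in> K'" for y
    proof -
      obtain a where "a \<in> A" "y = f a" using y K'(2) by blast
      with gF[of a] AE(1) show ?thesis by auto
    qed
    then have KA: "K \<subseteq> A" "f ` K = K'" by (auto simp: K_def image_image)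
    obtain \<delta> where \<delta>: "\<delta> > 0" "(\<Union>x\<in>K. ball x \<delta>) \<subseteq> U"
      using compact_subset_open_imp_ball_epsilon_subset[OF K U(1)] KA U(2) by auto
    have "measure \<nu> (f ` K) \<le> ?c * measure \<mu> (U \<inter> E)"
    proof (rule bilipschitz_measure_le_neighbourhood[OF E F C fE gF f g _ _ _ \<delta>(1)])
      show "f ` K \<in> sets \<nu>" using KA KF K'(1) by (simp add: F.sets_iff borel_compact)
      show "U \<inter> E \<in> sets \<mu>" using U(1) E.closed_carpet by (simp add: E.sets_iff)
      show "z \<in> U \<inter> E" if "a \<in> K" "z \<in> E" "dist a z < \<delta>" for a z
      proof -
        have "z \<in> (\<Union>x\<in>K. ball x \<delta>)" using that by (intro UN_I[of a]) (auto simp: mem_ball)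
        then show ?thesis using \<delta>(2) that(2) by blast
      qed
    qed (use KA AE in auto)
    also have "\<dots> \<le> ?c * (measure \<mu> A + \<epsilon>)" using U(3) c by (rule mult_left_mono)
    finally have "measure \<nu> (f ` A) \<le> ?c * measure \<mu> A + (?c + 1) * \<epsilon>"
      using K'(3) KA(2) by (simp add: algebra_simps)
    also have "(?c + 1) * \<epsilon> = e"
    proof -
      have "?c + 1 \<noteq> 0" using c by linarith
      then show ?thesis unfolding \<epsilon>_def by (rule nonzero_mult_div_cancel_left[of _ e, folded times_divide_eq_right])
    qed
    finally show "measure \<nu> (f ` A) \<le> ?c * measure \<mu> A + e" .
  qed
qed

section \<open>Equivalence of the measures\<close>

theorem theorem1p1:
  fixes n m :: nat
    and D\<^sub>E D\<^sub>F :: "(nat \<times> nat) set"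
    and E F :: "(real \<times> real) set"
    and \<mu>\<^sub>E \<mu>\<^sub>F :: "(real \<times> real) measure"
    and f :: "real \<times> real \<Rightarrow> real \<times> real"
  assumes "2 \<le> m" and "m < n"
    and "digit_set n m D\<^sub>E" and "is_carpet n m D\<^sub>E E" and "totally_disconnected E"
    and "digit_set n m D\<^sub>F" and "is_carpet n m D\<^sub>F F" and "totally_disconnected F"
    and "is_uniform_bernoulli n m D\<^sub>E E \<mu>\<^sub>E" and "is_uniform_bernoulli n m D\<^sub>F F \<mu>\<^sub>F"
    and "bi_lipschitz_on E f" and "f ` E = F"
  shows "\<exists>\<zeta>>0. \<forall>A. A \<in> sets borel \<and> A \<subseteq> E \<longrightarrow>
           inverse \<zeta> * measure \<mu>\<^sub>E A \<le> measure \<mu>\<^sub>F (f ` A) \<and>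
           measure \<mu>\<^sub>F (f ` A) \<le> \<zeta> * measure \<mu>\<^sub>E A"
proof -
  have E: "bernoulli_carpet n m D\<^sub>E E \<mu>\<^sub>E" and F: "bernoulli_carpet n m D\<^sub>F F \<mu>\<^sub>F"
    using assms by (auto intro: bernoulli_carpet.intro)
  obtain C where C: "C > 0"
    and low: "\<And>x y. x \<in> E \<Longrightarrow> y \<in> E \<Longrightarrow> inverse C * dist x y \<le> dist (f x) (f y)"
    and f: "\<And>x y. x \<in> E \<Longrightarrow> y \<in> E \<Longrightarrow> dist (f x) (f y) \<le> C * dist x y"
    using assms(11) unfolding bi_lipschitz_on_def by blast
  have low': "dist x y \<le> C * dist (f x) (f y)" if "x \<in> E" "y \<in> E" for x y
    using low[OF that] C by (simp add: field_simps)
  have inj: "inj_on f E"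
  proof (rule inj_onI)
    fix x y assume "x \<in> E" "y \<in> E" "f x = f y"
    then show "x = y" using low'[of x y] by simp
  qed
  define g where "g = inv_into E f"
  have gf: "g (f x) = x" if "x \<in> E" for x using inj that by (simp add: g_def)
  have gE: "g ` F = E" using gf by (simp add: image_image flip: assms(12))
  have fg: "f (g y) = y" if "y \<in> F" for y
    unfolding g_def by (rule f_inv_into_f) (use that assms(12) in blast)
  have g: "dist (g x) (g y) \<le> C * dist x y" if "x \<in> F" "y \<in> F" for x y
  proof -
    have "g x \<in> E" "g y \<in> E" using that gE by blast+
    from low'[OF this] show ?thesis using that by (simp add: fg)
  qed
  define \<zeta> where "\<zeta> = 256 * real (box_distortion m C) ^ 2"
  have \<zeta>: "\<zeta> > 0" by (simp add: \<zeta>_def box_distortion_def)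
  show ?thesis
  proof (intro exI[of _ \<zeta>] conjI allI impI \<zeta>)
    fix A assume A: "A \<in> sets borel \<and> A \<subseteq> E"
    then have A': "A \<in> sets \<mu>\<^sub>E" by (simp add: bernoulli_carpet.sets_iff[OF E])
    note 1 = bilipschitz_measure_le[OF E F C assms(12) gf f g A']
    show "measure \<mu>\<^sub>F (f ` A) \<le> \<zeta> * measure \<mu>\<^sub>E A" unfolding \<zeta>_def by (rule 1(2))
    have "g ` f ` A = (\<lambda>x. x) ` A" unfolding image_image using A gf by (intro image_cong) auto
    then have "measure \<mu>\<^sub>E A \<le> \<zeta> * measure \<mu>\<^sub>F (f ` A)"
      using bilipschitz_measure_le(2)[OF F E C gE fg g f 1(1)] unfolding \<zeta>_def by simp
    then show "inverse \<zeta> * measure \<mu>\<^sub>E A \<le> measure \<mu>\<^sub>F (f ` A)" using \<zeta> by (simp add: field_simps)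
  qed
qed

end
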